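(* Let $(X,p,E)$ be a lattice-normed space, where $(E,\|\cdot\|_E)$ is an order continuous (respectively, $\sigma$-order continuous) normed lattice, and let $(Y,m,F)$ be a lattice-normed space, where $(F,\|\cdot\|_F)$ is an atomic Banach lattice. Let $T:X\to Y$ be a linear operator such that: (i) $T:(X,p\text{-}\|\cdot\|_E)\to(Y,m\text{-}\|\cdot\|_F)$ is norm continuous, and (ii) $T:(X,p,E)\to(Y,m,F)$ is $p$-bounded. Then $T:(X,p,E)\to(Y,m,F)$ is $p$-continuous (respectively, sequentially $p$-continuous).
   Context: All vector lattices are real and Archimedean. A net $(x_\alpha)$ in a vector lattice $X$ order converges to $x$ (written $x_\alpha\xrightarrow{o}x$) if there is a net $(y_\beta)_{\beta\in B}$ (possibly with a different index set) with $y_\beta\downarrow 0$ such that for every $\beta$ there is $\alpha_\beta$ with $|x_\alpha-x|\le y_\beta$ for all $\alpha\ge\alpha_\beta$. A lattice-normed space (LNS) is a triple $(X,p,E)$ with $X$ a real vector space, $E$ a vector lattice and $p:X\to E_+$ such that $p(x)=0\Leftrightarrow x=0$, $p(\lambda x)=|\lambda|p(x)$, $p(x+y)\le p(x)+p(y)$. A net $x_\alpha$ $p$-converges to $x$ (written $x_\alpha\xrightarrow{p}x$) if $p(x_\alpha-x)\xrightarrow{o}0$ in $E$. A subset $A\subseteq X$ is $p$-bounded if there is $e\in E$ with $p(a)\le e$ for all $a\in A$. A linear operator $T:(X,p,E)\to(Y,m,F)$ is $p$-continuous if $x_\alpha\xrightarrow{p}0$ implies $Tx_\alpha\xrightarrow{p}0$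 for nets, sequentially $p$-continuous if this holds for sequences, and $p$-bounded if it maps $p$-bounded sets to $p$-bounded sets. If $(E,\|\cdot\|_E)$ is a normed lattice, the mixed norm on $X$ is $p\text{-}\|x\|_E=\|p(x)\|_E$; similarly $m\text{-}\|y\|_F=\|m(y)\|_F$. A normed lattice is order continuous (respectively, $\sigma$-order continuous) if every net (respectively, sequence) order converging to $0$ converges to $0$ in norm. An atom of a vector lattice $F$ is an element $a>0$ such that $0\le x\le a$ implies $x=\lambda a$ for some real $\lambda$; $F$ is atomic if every $x>0$ in $F$ dominates some atom (equivalently, the band generated by the atoms is $F$). *)

theory Defs
  imports "HOL-Analysis.Analysis" "HOL-Library.Lattice_Algebras"
begin

class vector_lattice = ordered_real_vector + lattice_ab_group_add_abs +
  assumes archimedean: "0 \<le> x \<Longrightarrow> (\<And>n::nat. real n *\<^sub>R x \<le> y) \<Longrightarrow> x = 0"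

class normed_lattice = real_normed_vector + vector_lattice +
  assumes norm_mono: "\<bar>x\<bar> \<le> \<bar>y\<bar> \<Longrightarrow> norm x \<le> norm y"

class banach_lattice = normed_lattice + banach

instance real :: banach_lattice
proof
  fix x y :: real
  assume "0 \<le> x" and *: "\<And>n::nat. real n *\<^sub>R x \<le> y"
  show "x = 0"
  proof (rule ccontr)
    assume "x \<noteq> 0"
    with \<open>0 \<le> x\<close> obtain n where "y < real n * x"
      using reals_Archimedean3[of x] by auto
    with *[of n] show False by simp
  qed
qed simp_all

definition atom :: "'f::vector_lattice \<Rightarrow> bool" where
  "atom a \<longleftrightarrow> 0 < a \<and> (\<forall>x. 0 \<le> x \<and> x \<le> a \<longrightarrow> (\<exists>c::real. x = c *\<^sub>R a))"

definition atomic_lattice :: "'f::vector_lattice itself \<Rightarrow> bool" where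
  "atomic_lattice F \<longleftrightarrow> (\<forall>x::'f. 0 < x \<longrightarrow> (\<exists>a. atom a \<and> a \<le> x))"

text \<open>A net is a function restricted to a set \<open>A\<close> that is directed by a preorder \<open>le\<close>; no
  antisymmetry is required.\<close>

definition directed_set :: "'i set \<Rightarrow> ('i \<Rightarrow> 'i \<Rightarrow> bool) \<Rightarrow> bool" where
  "directed_set A le \<longleftrightarrow> A \<noteq> {} \<and> reflp_on A le \<and> transp_on A le \<and>
     (\<forall>a\<in>A. \<forall>b\<in>A. \<exists>c\<in>A. le a c \<and> le b c)"

definition net_filter :: "'i set \<Rightarrow> ('i \<Rightarrow> 'i \<Rightarrow> bool) \<Rightarrow> 'i filter" where
  "net_filter A le = (INF a\<in>A. principal {b \<in> A. le a b})"

lemma eventually_net_filter: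
  assumes "directed_set A le"
  shows "eventually P (net_filter A le) \<longleftrightarrow> (\<exists>a\<in>A. \<forall>b\<in>A. le a b \<longrightarrow> P b)"
proof -
  have tr: "le a b \<Longrightarrow> le b c \<Longrightarrow> a \<in> A \<Longrightarrow> b \<in> A \<Longrightarrow> c \<in> A \<Longrightarrow> le a c" for a b c
    using assms by (auto simp: directed_set_def dest: transp_onD)
  have "eventually P (net_filter A le) \<longleftrightarrow> (\<exists>a\<in>A. eventually P (principal {b \<in> A. le a b}))"
    unfolding net_filter_def
  proof (rule eventually_INF_base)
    show "A \<noteq> {}" using assms by (simp add: directed_set_def)
    fix a b assume "a \<in> A" "b \<in> A"
    then obtain c where "c \<in> A" "le a c" "le b c"
      using assms unfolding directed_set_def by blast
    with \<open>a \<in> A\<close> \<open>b \<in> A\<close>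
    show "\<exists>x\<in>A. principal {b \<in> A. le x b}
            \<le> inf (principal {b \<in> A. le a b}) (principal {c \<in> A. le b c})"
      by (intro bexI[of _ c]) (auto intro: tr)
  qed
  then show ?thesis by (auto simp: eventually_principal)
qed

definition net_decreases_to_0 ::
    "'b set \<Rightarrow> ('b \<Rightarrow> 'b \<Rightarrow> bool) \<Rightarrow> ('b \<Rightarrow> 'e::vector_lattice) \<Rightarrow> bool" where
  "net_decreases_to_0 B le y \<longleftrightarrow> directed_set B le \<and>
     (\<forall>b\<in>B. \<forall>c\<in>B. le b c \<longrightarrow> y c \<le> y b) \<and>
     (\<forall>b\<in>B. 0 \<le> y b) \<and> (\<forall>z. (\<forall>b\<in>B. z \<le> y b) \<longrightarrow> z \<le> 0)"

text \<open>The index type of the dominating net is fixed to \<open>'e\<close>. This loses nothing, because a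
  decreasing net can be reindexed by its range: see \<open>order_convergesI\<close>.\<close>

definition order_converges ::
    "'i set \<Rightarrow> ('i \<Rightarrow> 'i \<Rightarrow> bool) \<Rightarrow> ('i \<Rightarrow> 'e::vector_lattice) \<Rightarrow> 'e \<Rightarrow> bool" where
  "order_converges A le x l \<longleftrightarrow>
     (\<exists>(B :: 'e set) leB y. net_decreases_to_0 B leB y \<and>
        (\<forall>b\<in>B. \<exists>a\<in>A. \<forall>a'\<in>A. le a a' \<longrightarrow> \<bar>x a' - l\<bar> \<le> y b))"

lemma net_decreases_to_0_range:
  assumes "net_decreases_to_0 B le y"
  shows "net_decreases_to_0 (y ` B) (\<lambda>u v. v \<le> u) (\<lambda>u. u)"
  unfolding net_decreases_to_0_def directed_set_def
proof (intro conjI)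
  have dir: "directed_set B le" and anti: "\<And>b c. b \<in> B \<Longrightarrow> c \<in> B \<Longrightarrow> le b c \<Longrightarrow> y c \<le> y b"
    and nonneg: "\<forall>b\<in>B. 0 \<le> y b" and inf: "\<forall>z. (\<forall>b\<in>B. z \<le> y b) \<longrightarrow> z \<le> 0"
    using assms by (auto simp: net_decreases_to_0_def)
  show "y ` B \<noteq> {}" using dir by (simp add: directed_set_def)
  show "reflp_on (y ` B) (\<lambda>u v. v \<le> u)" by (simp add: reflp_on_def)
  show "transp_on (y ` B) (\<lambda>u v. v \<le> u)" by (auto simp: transp_on_def)
  have "\<exists>d\<in>B. y d \<le> y b \<and> y d \<le> y c" if "b \<in> B" "c \<in> B" for b c
  proof -
    obtain d where "d \<in> B" "le b d" "le c d"
      using dir \<open>b \<in> B\<close> \<open>c \<in> B\<close> unfolding directed_set_def by blast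
    then show ?thesis using anti that by blast
  qed
  then show "\<forall>a\<in>y ` B. \<forall>b\<in>y ` B. \<exists>c\<in>y ` B. c \<le> a \<and> c \<le> b" by blast
  show "\<forall>b\<in>y ` B. \<forall>c\<in>y ` B. c \<le> b \<longrightarrow> c \<le> b" by blast
  show "\<forall>b\<in>y ` B. 0 \<le> b" using nonneg by blast
  show "\<forall>z. (\<forall>b\<in>y ` B. z \<le> b) \<longrightarrow> z \<le> 0" using inf by blast
qed

lemma order_convergesI:
  fixes B :: "'b set" and x :: "'i \<Rightarrow> 'e::vector_lattice"
  assumes "net_decreases_to_0 B leB y"
    and "\<forall>b\<in>B. \<exists>a\<in>A. \<forall>a'\<in>A. le a a' \<longrightarrow> \<bar>x a' - l\<bar> \<le> y b"
  shows "order_converges A le x l"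
  unfolding order_converges_def
  using net_decreases_to_0_range[OF assms(1)] assms(2)
  by (intro exI[of _ "y ` B"] exI[of _ "\<lambda>u v. v \<le> u"] exI[of _ "\<lambda>u. u"]) auto

text \<open>Order continuity tests nets with index type \<open>'e\<close> only, which again loses nothing: see
  \<open>order_continuous_normD\<close>.\<close>

definition order_continuous_norm :: "'e::normed_lattice itself \<Rightarrow> bool" where
  "order_continuous_norm E \<longleftrightarrow>
     (\<forall>(A :: 'e set) le (x :: 'e \<Rightarrow> 'e). directed_set A le \<longrightarrow> order_converges A le x 0 \<longrightarrow>
        (x \<longlongrightarrow> 0) (net_filter A le))"

definition sigma_order_continuous_norm :: "'e::normed_lattice itself \<Rightarrow> bool" where
  "sigma_order_continuous_norm E \<longleftrightarrow>
     (\<forall>x :: nat \<Rightarrow> 'e. order_converges UNIV (\<le>) x 0 \<longrightarrow> x \<longlonglongrightarrow> 0)"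

lemma order_continuous_normD:
  fixes A :: "'i set" and x :: "'i \<Rightarrow> 'e::normed_lattice"
  assumes E: "order_continuous_norm TYPE('e)"
    and dir: "directed_set A le" and conv: "order_converges A le x 0"
  shows "(x \<longlongrightarrow> 0) (net_filter A le)"
proof (rule ccontr)
  assume "\<not> (x \<longlongrightarrow> 0) (net_filter A le)"
  then obtain \<epsilon> where \<epsilon>: "\<epsilon> > 0"
    and large: "\<And>a. a \<in> A \<Longrightarrow> \<exists>a'\<in>A. le a a' \<and> \<epsilon> \<le> norm (x a')"
    by (auto simp: tendsto_iff eventually_net_filter[OF dir] not_less)
  obtain B :: "'e set" and leB y where dec: "net_decreases_to_0 B leB y"
    and dom: "\<forall>b\<in>B. \<exists>a\<in>A. \<forall>a'\<in>A. le a a' \<longrightarrow> \<bar>x a' - 0\<bar> \<le> y b"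
    using conv unfolding order_converges_def by blast
  have "\<forall>b\<in>B. \<exists>v. \<bar>v\<bar> \<le> y b \<and> \<epsilon> \<le> norm v"
    using dom large by (metis diff_zero)
  then obtain v where v: "\<And>b. b \<in> B \<Longrightarrow> \<bar>v b\<bar> \<le> y b" "\<And>b. b \<in> B \<Longrightarrow> \<epsilon> \<le> norm (v b)"
    by metis
  have dirB: "directed_set B leB" and anti: "\<And>b c. b \<in> B \<Longrightarrow> c \<in> B \<Longrightarrow> leB b c \<Longrightarrow> y c \<le> y b"
    using dec by (auto simp: net_decreases_to_0_def)
  have "order_converges B leB v 0"
  proof (rule order_convergesI[OF dec], intro ballI)
    fix b assume "b \<in> B"
    then have "\<forall>c\<in>B. leB b c \<longrightarrow> \<bar>v c - 0\<bar> \<le> y b"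
      using v(1) anti by (metis diff_zero order_trans)
    with \<open>b \<in> B\<close> show "\<exists>a\<in>B. \<forall>c\<in>B. leB a c \<longrightarrow> \<bar>v c - 0\<bar> \<le> y b" by blast
  qed
  with E dirB have "(v \<longlongrightarrow> 0) (net_filter B leB)"
    unfolding order_continuous_norm_def by blast
  then obtain b where "b \<in> B" "\<forall>c\<in>B. leB b c \<longrightarrow> norm (v c) < \<epsilon>"
    using \<epsilon> by (auto simp: tendsto_iff eventually_net_filter[OF dirB])
  moreover have "leB b b"
    using dirB \<open>b \<in> B\<close> by (auto simp: directed_set_def dest: reflp_onD)
  ultimately show False using v(2)[of b] by force
qed

locale lattice_normed_space =
  fixes p :: "'x::real_vector \<Rightarrow> 'e::vector_lattice"
  assumes nonneg: "0 \<le> p x"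
    and eq_0_iff: "p x = 0 \<longleftrightarrow> x = 0"
    and scaleR: "p (c *\<^sub>R x) = \<bar>c\<bar> *\<^sub>R p x"
    and triangle: "p (x + y) \<le> p x + p y"

definition p_converges ::
    "'i set \<Rightarrow> ('i \<Rightarrow> 'i \<Rightarrow> bool) \<Rightarrow> ('x::real_vector \<Rightarrow> 'e::vector_lattice) \<Rightarrow> ('i \<Rightarrow> 'x) \<Rightarrow> 'x \<Rightarrow> bool"
  where "p_converges A le p x l \<longleftrightarrow> order_converges A le (\<lambda>a. p (x a - l)) 0"

definition p_bounded_set :: "('x::real_vector \<Rightarrow> 'e::vector_lattice) \<Rightarrow> 'x set \<Rightarrow> bool" where
  "p_bounded_set p A \<longleftrightarrow> (\<exists>e. \<forall>a\<in>A. p a \<le> e)"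

definition p_bounded_operator ::
    "('x::real_vector \<Rightarrow> 'e::vector_lattice) \<Rightarrow> ('y::real_vector \<Rightarrow> 'f::vector_lattice) \<Rightarrow> ('x \<Rightarrow> 'y) \<Rightarrow> bool"
  where "p_bounded_operator p m T \<longleftrightarrow> (\<forall>A. p_bounded_set p A \<longrightarrow> p_bounded_set m (T ` A))"

text \<open>The first argument is the index type of the nets that are tested.\<close>

definition p_continuous ::
    "'i itself \<Rightarrow> ('x::real_vector \<Rightarrow> 'e::vector_lattice) \<Rightarrow> ('y::real_vector \<Rightarrow> 'f::vector_lattice) \<Rightarrow> ('x \<Rightarrow> 'y) \<Rightarrow> bool"
  where "p_continuous I p m T \<longleftrightarrow>
     (\<forall>(A :: 'i set) le x. directed_set A le \<longrightarrow> p_converges A le p x 0 \<longrightarrow>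
        p_converges A le m (\<lambda>a. T (x a)) 0)"

definition sequentially_p_continuous ::
    "('x::real_vector \<Rightarrow> 'e::vector_lattice) \<Rightarrow> ('y::real_vector \<Rightarrow> 'f::vector_lattice) \<Rightarrow> ('x \<Rightarrow> 'y) \<Rightarrow> bool"
  where "sequentially_p_continuous p m T \<longleftrightarrow>
     (\<forall>x :: nat \<Rightarrow> 'x. p_converges UNIV (\<le>) p x 0 \<longrightarrow> p_converges UNIV (\<le>) m (\<lambda>n. T (x n)) 0)"

definition mixed_norm :: "('x::real_vector \<Rightarrow> 'e::normed_lattice) \<Rightarrow> 'x \<Rightarrow> real" where
  "mixed_norm p x = norm (p x)"

definition mixed_topology :: "('x::real_vector \<Rightarrow> 'e::normed_lattice) \<Rightarrow> 'x topology" where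
  "mixed_topology p = Metric_space.mtopology UNIV (\<lambda>x y. mixed_norm p (x - y))"

lemma Metric_space_mixed_norm:
  fixes p :: "'x::real_vector \<Rightarrow> 'e::normed_lattice"
  assumes "lattice_normed_space p"
  shows "Metric_space UNIV (\<lambda>x y. mixed_norm p (x - y))"
proof -
  interpret lattice_normed_space p by fact
  show ?thesis
  proof
    fix x y z
    show "0 \<le> mixed_norm p (x - y)" by (simp add: mixed_norm_def)
    show "mixed_norm p (x - y) = mixed_norm p (y - x)"
      using scaleR[of "-1" "x - y"] by (simp add: mixed_norm_def)
    show "mixed_norm p (x - y) = 0 \<longleftrightarrow> x = y" by (simp add: mixed_norm_def eq_0_iff)
    have "\<bar>p (x - z)\<bar> \<le> \<bar>p (x - y) + p (y - z)\<bar>"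
      using triangle[of "x - y" "y - z"] nonneg[of "x - z"] nonneg[of "x - y"] nonneg[of "y - z"]
      by simp
    then show "mixed_norm p (x - z) \<le> mixed_norm p (x - y) + mixed_norm p (y - z)"
      unfolding mixed_norm_def using norm_mono norm_triangle_ineq order_trans by blast
  qed
qed

end

theory Submission
  imports Defs
begin

text \<open>By order continuity of the norm of \<open>E\<close> and norm continuity of \<open>T\<close>, a \<open>p\<close>-null net \<open>x\<close>
  yields a norm null net \<open>u\<^sub>\<alpha> = m (T x\<^sub>\<alpha>)\<close> in \<open>F\<close>, which is eventually order bounded because \<open>T\<close> is
  \<open>p\<close>-bounded. Let \<open>D\<close> be the set of eventual upper bounds of \<open>u\<close>, which is directed downwards.
  If its infimum were not \<open>0\<close>, some atom \<open>a\<close> would lie below \<open>D\<close>. As \<open>u\<close> is norm null, eventually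
  \<open>inf u\<^sub>\<alpha> a \<le> a / 2\<close>, so for \<open>y \<in> D\<close> eventually
  \<open>u\<^sub>\<alpha> + a = sup u\<^sub>\<alpha> a + inf u\<^sub>\<alpha> a \<le> y + a / 2\<close>, that is, \<open>y - a / 2 \<in> D\<close>. Iterating this
  contradicts the Archimedean property.\<close>

text \<open>Lying between 0 and the atom, \<open>inf u a\<close> is some multiple
  \<open>c *\<^sub>R a\<close>; monotonicity of the norm bounds
  \<open>\<bar>c\<bar> * norm a\<close> by \<open>norm u\<close>, which forces
  \<open>\<bar>c\<bar> < 1/2\<close>.\<close>

lemma atom_inf_le_half:
  fixes a u :: "'f::normed_lattice"
  assumes "atom a" "0 \<le> u" "norm u < norm a / 2"
  shows "inf u a \<le> (1/2) *\<^sub>R a"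
proof -
  have "0 < a" using assms(1) by (simp add: atom_def)
  then have "0 \<le> inf u a" using assms(2) by simp
  moreover have "inf u a \<le> a" by simp
  ultimately obtain c where c: "inf u a = c *\<^sub>R a"
    using assms(1) unfolding atom_def by blast
  have "\<bar>inf u a\<bar> \<le> \<bar>u\<bar>" using \<open>0 \<le> inf u a\<close> assms(2) by simp
  then have "\<bar>c\<bar> * norm a \<le> norm u" using norm_mono[of "inf u a" u] c by simp
  with assms(3) have "\<bar>c\<bar> * norm a < (1/2) * norm a" by simp
  then have "\<bar>c\<bar> < 1/2" by (rule mult_right_less_imp_less) simp
  then have "c \<le> 1/2" by simp
  then show ?thesis using c \<open>0 < a\<close> by (simp add: scaleR_right_mono)
qed

lemma order_converges_0_if_norm_tendsto_0:
  fixes u :: "'i \<Rightarrow> 'f::normed_lattice"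
  assumes atomic: "atomic_lattice TYPE('f)" and dir: "directed_set A le"
    and nonneg: "\<And>i. 0 \<le> u i" and bdd: "\<forall>\<^sub>F i in net_filter A le. u i \<le> f"
    and null: "(u \<longlongrightarrow> 0) (net_filter A le)"
  shows "order_converges A le u 0"
proof -
  define D where "D = {y. 0 \<le> y \<and> (\<forall>\<^sub>F i in net_filter A le. u i \<le> y)}"
  \<comment> \<open>Nontriviality supplies an actual index \<open>i\<close> with
    \<open>0 \<le> u i \<le> f\<close>, hence \<open>0 \<le> f\<close>, as membership in
    \<open>D\<close> demands.\<close>
  have nontriv: "net_filter A le \<noteq> bot"
    using dir eventually_net_filter[OF dir, of "\<lambda>_. False"]
    by (auto simp: trivial_limit_def directed_set_def dest: reflp_onD)
  have f: "f \<in> D"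
  proof -
    obtain i where "u i \<le> f" using eventually_happens'[OF nontriv bdd] by blast
    then show ?thesis using bdd nonneg[of i] by (auto simp: D_def intro: order_trans)
  qed
  have inf_D: "inf y z \<in> D" if "y \<in> D" "z \<in> D" for y z
    using that by (auto simp: D_def elim: eventually_elim2)
  have lower: "z \<le> 0" if z: "\<forall>y\<in>D. z \<le> y" for z
  proof (rule ccontr)
    assume "\<not> z \<le> 0"
    \<comment> \<open>The positive part replaces \<open>z\<close>: it is strictly positive, so it
      dominates an atom, and it is still below all of \<open>D\<close>, whose members are
      nonnegative.\<close>
    then have "sup z 0 \<noteq> 0" by (metis sup_ge1)
    then have "0 < sup z 0" by (simp add: order_less_le)
    then obtain a where a: "atom a" "a \<le> sup z 0"
      using atomic unfolding atomic_lattice_def by blast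
    have "0 < a" using a(1) by (simp add: atom_def)
    have a_le: "a \<le> y" if "y \<in> D" for y
    proof -
      have "sup z 0 \<le> y" using z that by (auto simp: D_def)
      with a(2) show ?thesis by (rule order_trans)
    qed
    have "0 < norm a / 2" using \<open>0 < a\<close> by simp
    then have small: "\<forall>\<^sub>F i in net_filter A le. norm (u i) < norm a / 2"
      using tendstoD[OF null, of "norm a / 2"] by simp
    have step: "y - (1/2) *\<^sub>R a \<in> D" if y: "y \<in> D" for y
    proof -
      have "(1/2) *\<^sub>R a \<le> a"
        using scaleR_right_mono[of "1/2" 1 a] \<open>0 < a\<close> by simp
      then have "(1/2) *\<^sub>R a \<le> y" using a_le[OF y] by (rule order_trans)
      then have "0 \<le> y - (1/2) *\<^sub>R a" by simp
      moreover have "\<forall>\<^sub>F i in net_filter A le. u i \<le> y"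
        using y by (simp add: D_def)
      with small have "\<forall>\<^sub>F i in net_filter A le. u i \<le> y - (1/2) *\<^sub>R a"
      proof eventually_elim
        case (elim i)
        have "u i + a = sup (u i) a + inf (u i) a" by (rule add_eq_inf_sup)
        also have "\<dots> \<le> y + (1/2) *\<^sub>R a"
          using elim a_le[OF y] atom_inf_le_half[OF a(1) nonneg elim(1)] by (intro add_mono) auto
        finally have "u i \<le> y + (1/2) *\<^sub>R a - a" by (simp add: le_diff_eq)
        also have "\<dots> = y - (1/2) *\<^sub>R a"
          using scaleR_left_distrib[of "1/2" "1/2" a] by (simp add: algebra_simps)
        finally show ?case .
      qed
      ultimately show ?thesis by (simp add: D_def)
    qed
    \<comment> \<open>Members of \<open>D\<close> are nonnegative, so all multiples of
      \<open>a / 2\<close> stay below the fixed element \<open>f\<close>.\<close>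
    have iter: "f - real n *\<^sub>R ((1/2) *\<^sub>R a) \<in> D" for n
    proof (induction n)
      case (Suc n)
      have "f - real (Suc n) *\<^sub>R h = f - real n *\<^sub>R h - h" for h
        by (simp add: algebra_simps)
      then show ?case using step[OF Suc] by (simp only:)
    qed (simp add: f)
    have "real n *\<^sub>R ((1/2) *\<^sub>R a) \<le> f" for n
    proof -
      have "0 \<le> f - real n *\<^sub>R ((1/2) *\<^sub>R a)" using iter[of n] unfolding D_def by blast
      then show ?thesis by (simp only: diff_ge_0_iff_ge)
    qed
    moreover have "0 \<le> (1/2) *\<^sub>R a" using \<open>0 < a\<close> by (intro scaleR_nonneg_nonneg) auto
    ultimately have "(1/2) *\<^sub>R a = 0" by (intro archimedean)
    with \<open>0 < a\<close> show False by simp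
  qed
  \<comment> \<open>\<open>D\<close>, indexed by itself in reversed order, is the dominating
    net.\<close>
  have "net_decreases_to_0 D (\<lambda>y z. z \<le> y) (\<lambda>y. y)"
    unfolding net_decreases_to_0_def directed_set_def
  proof (intro conjI)
    show "\<forall>y\<in>D. \<forall>z\<in>D. \<exists>w\<in>D. w \<le> y \<and> w \<le> z" using inf_D by (meson inf_le1 inf_le2)
    show "D \<noteq> {}" using f by blast
    show "reflp_on D (\<lambda>y z. z \<le> y)" by (simp add: reflp_on_def)
    show "transp_on D (\<lambda>y z. z \<le> y)" by (auto simp: transp_on_def)
    show "\<forall>y\<in>D. 0 \<le> y" unfolding D_def by blast
    show "\<forall>z. (\<forall>y\<in>D. z \<le> y) \<longrightarrow> z \<le> 0" using lower by blast
  qed blast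
  moreover have "\<forall>y\<in>D. \<exists>a\<in>A. \<forall>b\<in>A. le a b \<longrightarrow> \<bar>u b - 0\<bar> \<le> y"
    by (simp add: D_def eventually_net_filter[OF dir] nonneg)
  ultimately show ?thesis by (rule order_convergesI)
qed

lemma limitin_mixed_topology_0_iff:
  fixes p :: "'x::real_vector \<Rightarrow> 'e::normed_lattice"
  assumes "lattice_normed_space p"
  shows "limitin (mixed_topology p) x 0 F \<longleftrightarrow> ((\<lambda>i. p (x i)) \<longlongrightarrow> 0) F"
proof -
  interpret Metric_space UNIV "\<lambda>x y. mixed_norm p (x - y)"
    by (rule Metric_space_mixed_norm[OF assms])
  show ?thesis
    unfolding mixed_topology_def limitin_metric by (simp add: tendsto_iff mixed_norm_def)
qed

text \<open>Common core of the net and the sequence case: continuity of the norm of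
  \<open>'e\<close> serves only to supply the hypothesis \<open>null\<close>.\<close>

lemma p_converges_image:
  fixes p :: "'x::real_vector \<Rightarrow> 'e::normed_lattice"
    and m :: "'y::real_vector \<Rightarrow> 'f::normed_lattice"
  assumes p: "lattice_normed_space p" and m: "lattice_normed_space m"
    and atomic: "atomic_lattice TYPE('f)" and "linear T"
    and cont: "continuous_map (mixed_topology p) (mixed_topology m) T"
    and bdd: "p_bounded_operator p m T"
    and dir: "directed_set A le" and conv: "p_converges A le p x 0"
    and null: "((\<lambda>i. p (x i)) \<longlongrightarrow> 0) (net_filter A le)"
  shows "p_converges A le m (\<lambda>i. T (x i)) 0"
proof -
  have "T 0 = 0" using \<open>linear T\<close> by (rule linear_0)
  have "limitin (mixed_topology p) x 0 (net_filter A le)"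
    using null limitin_mixed_topology_0_iff[OF p] by blast
  from continuous_map_limit[OF cont this]
  have Tnull: "((\<lambda>i. m (T (x i))) \<longlongrightarrow> 0) (net_filter A le)"
    by (simp add: limitin_mixed_topology_0_iff[OF m] \<open>T 0 = 0\<close> o_def)
  obtain B :: "'e set" and leB y where "net_decreases_to_0 B leB y"
    and dom: "\<forall>b\<in>B. \<exists>a\<in>A. \<forall>a'\<in>A. le a a' \<longrightarrow> \<bar>p (x a' - 0) - 0\<bar> \<le> y b"
    using conv unfolding p_converges_def order_converges_def by blast
  \<comment> \<open>One dominating element suffices: a tail of \<open>x\<close> lies in the
    \<open>p\<close>-bounded set of all \<open>v\<close> with \<open>p v \<le> y b\<close>, whose
    image under \<open>T\<close> has an upper bound \<open>f\<close>.\<close>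
  then obtain b where "b \<in> B" by (auto simp: net_decreases_to_0_def directed_set_def)
  with dom have tail: "\<forall>\<^sub>F i in net_filter A le. p (x i) \<le> y b"
    by (auto simp: eventually_net_filter[OF dir] lattice_normed_space.nonneg[OF p])
  have "p_bounded_set p {v. p v \<le> y b}" by (auto simp: p_bounded_set_def)
  with bdd have "p_bounded_set m (T ` {v. p v \<le> y b})" by (simp add: p_bounded_operator_def)
  then obtain f where "p v \<le> y b \<Longrightarrow> m (T v) \<le> f" for v
    unfolding p_bounded_set_def by blast
  with tail have "\<forall>\<^sub>F i in net_filter A le. m (T (x i)) \<le> f"
    by (auto elim: eventually_mono)
  then show ?thesis
    using order_converges_0_if_norm_tendsto_0[OF atomic dir lattice_normed_space.nonneg[OF m] _ Tnull]
    by (simp add: p_converges_def)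
qed

lemma directed_set_nat: "directed_set (UNIV :: nat set) (\<le>)"
  unfolding directed_set_def
proof (intro conjI)
  show "\<forall>a\<in>UNIV. \<forall>b\<in>UNIV. \<exists>c\<in>UNIV. a \<le> c \<and> b \<le> (c::nat)"
    using max.cobounded1 max.cobounded2 by blast
qed simp_all

lemma net_filter_nat: "net_filter (UNIV :: nat set) (\<le>) = sequentially"
  by (simp add: filter_eq_iff eventually_net_filter[OF directed_set_nat] eventually_sequentially)

theorem theorem1:
  fixes p :: "'x::real_vector \<Rightarrow> 'e::normed_lattice"
    and m :: "'y::real_vector \<Rightarrow> 'f::banach_lattice"
    and T :: "'x \<Rightarrow> 'y"
  assumes "lattice_normed_space p"
    and "lattice_normed_space m"
    and "atomic_lattice TYPE('f)"
    and "linear T"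
    and "continuous_map (mixed_topology p) (mixed_topology m) T"
    and "p_bounded_operator p m T"
  shows "(order_continuous_norm TYPE('e) \<longrightarrow> p_continuous TYPE('i) p m T) \<and>
         (sigma_order_continuous_norm TYPE('e) \<longrightarrow> sequentially_p_continuous p m T)"
proof (intro conjI impI)
  assume E: "order_continuous_norm TYPE('e)"
  show "p_continuous TYPE('i) p m T"
    unfolding p_continuous_def
  proof (intro allI impI)
    fix A :: "'i set" and le x
    assume dir: "directed_set A le" and conv: "p_converges A le p x 0"
    then have "((\<lambda>i. p (x i)) \<longlongrightarrow> 0) (net_filter A le)"
      \<comment> \<open>This passes from nets indexed by \<open>'e\<close>, as in the definition of
        order continuity, to index type \<open>'i\<close>.\<close>
      by (intro order_continuous_normD[OF E dir]) (simp add: p_converges_def)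
    then show "p_converges A le m (\<lambda>i. T (x i)) 0"
      by (rule p_converges_image[OF assms dir conv])
  qed
next
  assume E: "sigma_order_continuous_norm TYPE('e)"
  show "sequentially_p_continuous p m T"
    unfolding sequentially_p_continuous_def
  proof (intro allI impI)
    fix x :: "nat \<Rightarrow> 'x"
    assume conv: "p_converges UNIV (\<le>) p x 0"
    then have "(\<lambda>i. p (x i)) \<longlonglongrightarrow> 0"
      using E by (simp add: sigma_order_continuous_norm_def p_converges_def)
    then show "p_converges UNIV (\<le>) m (\<lambda>i. T (x i)) 0"
      using p_converges_image[OF assms directed_set_nat conv] by (simp only: net_filter_nat)
  qed
qed

end
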